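(* For every nonnegative integer $n$ the following hold. (1) $$\sum_{m=0}^{n} \binom{2m}{m}^2 \binom{n+m}{n-m} (-4)^{n-m} = \begin{cases} \binom{2k}{k}^2 & \text{if } n = 2k \text{ is even},\\ 0 & \text{if } n \text{ is odd}.\end{cases}$$ (2) $$\sum_{m=0}^{n} \binom{2m}{m}^2 \binom{n-1/2}{n-m} (-1)^m\, 16^{n-m} = \binom{2n}{n}^2.$$ (3) $$\sum_{m=0}^{n} \binom{2m}{m}^2 \frac{16^{n-m}}{1-2m} = (2n+1)\binom{2n}{n}^2.$$ (4) $$\sum_{m=0}^{2n} \binom{2m}{m}^2 \binom{2n+m}{2m} (-1)^m\, 4^{2n-m} = \binom{2n}{n}^2.$$
   Context: For a nonnegative integer $n$, $\binom{2n}{n} = \frac{(2n)!}{(n!)^2}$ is the central binomial coefficient. For a real number $a$ and a nonnegative integer $j$, the generalized binomial coefficient is $\binom{a}{j} = \frac{a(a-1)\cdots(a-j+1)}{j!}$ (with $\binom{a}{0}=1$); in particular $\binom{n-1/2}{n-m} = \frac{(n-\tfrac12)(n-\tfrac32)\cdots(m+\tfrac12)}{(n-m)!}$. *)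

theory Defs
  imports Complex_Main
begin

end

theory Submission
  imports Defs "HOL-Computational_Algebra.Formal_Power_Series"
begin

text \<open>
  Write \<open>c m = (2m choose m)\<close>. For (1), \<open>c m * ((n+m) choose (n-m)) = (n+m)! / ((n-m)! (m!)\<^sup>2)\<close>
  is hypergeometric in \<open>n\<close> and \<open>m\<close>, and creative telescoping shows that the
  sum \<open>f n\<close> satisfies \<open>(n+2)\<^sup>2 f (n+2) = 16 (n+1)\<^sup>2 f n\<close>, which is also the recurrence of
  \<open>(c (n/2))\<^sup>2\<close>; (4) is (1) at \<open>2n\<close>. For (2), \<open>c m = (-4)^m (-1/2 gchoose m)\<close> and
  \<open>c m * (n-1/2 gchoose (n-m)) = 4^m / 4^n * c n * (n choose m)\<close>
  reduce the sum to Vandermonde's convolution. The sum (3) follows directly from the recurrence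
  of \<open>c\<close>.
\<close>

section \<open>Recurrence of the central binomial coefficients, and sum (3)\<close>

lemma central_binomial_Suc:
  "real (Suc m) * real ((2 * Suc m) choose Suc m) = 2 * (2 * real m + 1) * real ((2 * m) choose m)"
proof -
  have c: "real ((2 * k) choose k) = fact (2 * k) / (fact k * fact k)" for k
    by (subst binomial_fact) (simp_all add: mult_2)
  have "(fact (2 * Suc m) :: real) = 2 * (real m + 1) * (2 * real m + 1) * fact (2 * m)"
    by (simp add: algebra_simps)
  then show ?thesis
    unfolding c by (simp add: divide_simps) (simp add: algebra_simps)
qed

lemma central_binomial_Suc_sq:
  "(real (Suc m))\<^sup>2 * (real ((2 * Suc m) choose Suc m))\<^sup>2
     = 4 * (2 * real m + 1)\<^sup>2 * (real ((2 * m) choose m))\<^sup>2"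
  using arg_cong[OF central_binomial_Suc[of m], of "\<lambda>x. x\<^sup>2"] by (simp only: power_mult_distrib) simp

lemma sum_central_binomial_sq_div:
  "(\<Sum>m=0..n. (real ((2 * m) choose m))\<^sup>2 * (16 ^ (n - m) / (1 - 2 * real m)))
     = (2 * real n + 1) * (real ((2 * n) choose n))\<^sup>2"
proof (induction n)
  case 0
  then show ?case by simp
next
  case (Suc n)
  define x where "x = (real ((2 * Suc n) choose Suc n))\<^sup>2"
  define y where "y = (real ((2 * n) choose n))\<^sup>2"
  have xy: "(real n + 1)\<^sup>2 * x = 4 * (2 * real n + 1)\<^sup>2 * y"
    using central_binomial_Suc_sq[of n] by (simp add: x_def y_def add.commute)
  have "(\<Sum>m=0..n. (real ((2 * m) choose m))\<^sup>2 * (16 ^ (Suc n - m) / (1 - 2 * real m)))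
      = 16 * (\<Sum>m=0..n. (real ((2 * m) choose m))\<^sup>2 * (16 ^ (n - m) / (1 - 2 * real m)))"
    unfolding sum_distrib_left by (rule sum.cong) (simp_all add: Suc_diff_le)
  then have "(\<Sum>m=0..Suc n. (real ((2 * m) choose m))\<^sup>2 * (16 ^ (Suc n - m) / (1 - 2 * real m)))
      = 16 * ((2 * real n + 1) * y) + x / (1 - 2 * real (Suc n))"
    using Suc.IH by (simp add: x_def y_def)
  also have "\<dots> = (2 * real (Suc n) + 1) * x"
  proof -
    \<comment> \<open>The factor 2n + 1 clears the denominator 1 - 2(n + 1) = -(2n + 1). Since 1 +
      (2n + 1)(2n + 3) = 4(n + 1)^2, what remains is four times the difference of the two sides of
      \<open>xy\<close>.\<close>
    have "(2 * real n + 1) * (16 * ((2 * real n + 1) * y) - x / (2 * real n + 1) - (2 * real n + 3) * x)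
        = 4 * (4 * (2 * real n + 1)\<^sup>2 * y - (real n + 1)\<^sup>2 * x)"
      by (simp add: field_simps power2_eq_square)
    then have "16 * ((2 * real n + 1) * y) - x / (2 * real n + 1) - (2 * real n + 3) * x = 0"
      using xy by (simp add: add_nonneg_eq_0_iff)
    moreover have "x / (1 - 2 * real (Suc n)) = - (x / (2 * real n + 1))"
      by (simp add: minus_divide_right)
    ultimately show ?thesis by simp
  qed
  finally show ?case by (simp add: x_def)
qed

section \<open>Sum (2) by Vandermonde's convolution\<close>

text \<open>This is the coefficient form of the generating function (1 - 4x)^(-1/2) of the central
  binomial coefficients. Both sides have the same ratio of consecutive terms.\<close>

lemma gbinomial_minus_half: "((- 1 / 2 :: real) gchoose m) * (- 4) ^ m = real ((2 * m) choose m)"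
proof (induction m)
  case 0
  then show ?case by simp
next
  case (Suc m)
  have g: "real (Suc m) * ((- 1 / 2 :: real) gchoose Suc m) = (- 1 / 2 - real m) * (- 1 / 2 gchoose m)"
    using gbinomial_mult_1[of "- 1 / 2 :: real" m] by (simp add: algebra_simps)
  have "real (Suc m) * (((- 1 / 2 :: real) gchoose Suc m) * (- 4) ^ Suc m)
      = real (Suc m) * ((- 1 / 2 :: real) gchoose Suc m) * (- 4) ^ Suc m"
    by (simp only: mult.assoc)
  also have "\<dots> = 2 * (2 * real m + 1) * ((- 1 / 2 gchoose m) * (- 4) ^ m)"
    unfolding g by (simp add: algebra_simps)
  finally have "real (Suc m) * (((- 1 / 2 :: real) gchoose Suc m) * (- 4) ^ Suc m)
      = real (Suc m) * real ((2 * Suc m) choose Suc m)"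
    using Suc.IH central_binomial_Suc[of m] by simp
  then show ?case
    by (metis mult_cancel_left of_nat_eq_0_iff nat.distinct(1))
qed

text \<open>With m fixed, raising n by one multiplies either side by 2(2n + 1)/(n - m + 1), and at n
  = m both sides are the same central binomial coefficient.\<close>

lemma central_binomial_mult_gbinomial:
  assumes "m \<le> n"
  shows "real ((2 * m) choose m) * ((real n - 1 / 2) gchoose (n - m)) * 4 ^ (n - m)
           = real ((2 * n) choose n) * real (n choose m)"
  using assms
proof (induction n rule: dec_induct)
  case base
  then show ?case by simp
next
  case (step n)
  let ?g = "(real n - 1 / 2) gchoose (n - m)"
  let ?h = "(real (Suc n) - 1 / 2) gchoose (Suc n - m)"
  \<comment> \<open>Upper and lower index grow together here, so this is absorption with upper entry
    (n + 1) - 1/2.\<close>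
  have h: "(real n - real m + 1) * ?h = (real n + 1 / 2) * ?g"
    using gbinomial_absorption[of "n - m" "real n + 1 / 2"] step(1)
    by (simp add: Suc_diff_le of_nat_diff algebra_simps)
  have "(Suc n - m) * (Suc n choose m) = Suc n * (n choose m)"
    using binomial_absorb_comp[of "Suc n" m] by simp
  then have "real (Suc n - m) * real (Suc n choose m) = real (Suc n) * real (n choose m)"
    by (metis of_nat_mult)
  then have b: "(real n - real m + 1) * real (Suc n choose m) = (real n + 1) * real (n choose m)"
    using step(1) by (simp add: of_nat_diff algebra_simps)
  have c: "(real n + 1) * real ((2 * Suc n) choose Suc n) = 2 * (2 * real n + 1) * real ((2 * n) choose n)"
    using central_binomial_Suc[of n] by (simp add: add.commute)
  have "(real n - real m + 1) * (real ((2 * m) choose m) * ?h * 4 ^ (Suc n - m))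
      = 4 * ((real n - real m + 1) * ?h) * (real ((2 * m) choose m) * 4 ^ (n - m))"
    using step(1) by (simp add: Suc_diff_le)
  also have "\<dots> = 4 * (real n + 1 / 2) * (real ((2 * m) choose m) * ?g * 4 ^ (n - m))"
    unfolding h by (simp only: mult_ac)
  also have "\<dots> = (2 * (2 * real n + 1) * real ((2 * n) choose n)) * real (n choose m)"
    unfolding step.IH by (simp add: algebra_simps)
  also have "\<dots> = (real n - real m + 1) * (real ((2 * Suc n) choose Suc n) * real (Suc n choose m))"
    unfolding c[symmetric] using b by (metis mult.assoc mult.commute)
  finally show ?case
    using step(1) by (simp add: add_eq_0_iff)
qed

lemma sum_central_binomial_sq_gbinomial:
  "(\<Sum>m=0..n. (real ((2 * m) choose m))\<^sup>2 * ((real n - 1 / 2) gchoose (n - m)) * (- 1) ^ m * 16 ^ (n - m))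
     = (real ((2 * n) choose n))\<^sup>2"
proof -
  define c where "c k = real ((2 * k) choose k)" for k
  have "(c m)\<^sup>2 * ((real n - 1 / 2) gchoose (n - m)) * (- 1) ^ m * 16 ^ (n - m)
      = c n * 4 ^ n * ((- 1 / 2 gchoose m) * (real n gchoose (n - m)))" if "m \<le> n" for m
  proof -
    \<comment> \<open>One factor \<open>4 ^ (n - m)\<close> is used up by
      \<open>central_binomial_mult_gbinomial\<close>; the other merges with the signs and powers of
      \<open>gbinomial_minus_half\<close> into \<open>4 ^ n\<close>, which is independent of
      m.\<close>
    have s: "(16 :: real) ^ (n - m) = 4 ^ (n - m) * 4 ^ (n - m)"
      by (simp flip: power_mult_distrib)
    have p: "(- 4 :: real) ^ m * (- 1) ^ m * 4 ^ (n - m) = 4 ^ n"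
      using that by (simp flip: power_mult_distrib power_add)
    have "(c m)\<^sup>2 * ((real n - 1 / 2) gchoose (n - m)) * (- 1) ^ m * 16 ^ (n - m)
        = (c m * ((real n - 1 / 2) gchoose (n - m)) * 4 ^ (n - m)) * c m * (- 1) ^ m * 4 ^ (n - m)"
      by (simp add: s power2_eq_square)
    also have "\<dots> = c n * real (n choose m) * ((- 1 / 2 gchoose m) * (- 4) ^ m) * (- 1) ^ m * 4 ^ (n - m)"
      unfolding c_def central_binomial_mult_gbinomial[OF that] gbinomial_minus_half by simp
    also have "\<dots> = c n * real (n choose m) * (- 1 / 2 gchoose m) * ((- 4) ^ m * (- 1) ^ m * 4 ^ (n - m))"
      by (simp only: mult_ac)
    also have "\<dots> = c n * real (n choose m) * (- 1 / 2 gchoose m) * 4 ^ n"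
      by (simp only: p)
    also have "real (n choose m) = real n gchoose (n - m)"
      using binomial_symmetric[OF that] by (simp add: binomial_gbinomial)
    finally show ?thesis by (simp only: mult_ac)
  qed
  then have "(\<Sum>m=0..n. (c m)\<^sup>2 * ((real n - 1 / 2) gchoose (n - m)) * (- 1) ^ m * 16 ^ (n - m))
      = c n * 4 ^ n * (\<Sum>m=0..n. (- 1 / 2 gchoose m) * (real n gchoose (n - m)))"
    unfolding sum_distrib_left by (intro sum.cong) auto
  also have "(\<Sum>m=0..n. (- 1 / 2 gchoose m) * (real n gchoose (n - m))) = (real n - 1 / 2) gchoose n"
    using gbinomial_Vandermonde[of "- 1 / 2 :: real" "real n" n] by (simp add: atMost_atLeast0)
  \<comment> \<open>At m = 0 the product formula turns the Vandermonde value back into a second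
    factor \<open>c n\<close>.\<close>
  also have "c n * 4 ^ n * ((real n - 1 / 2) gchoose n) = (c n)\<^sup>2"
    using central_binomial_mult_gbinomial[of 0 n] by (simp add: c_def power2_eq_square mult.commute)
  finally show ?thesis unfolding c_def .
qed

section \<open>Creative telescoping for the sum (1), normalised by (-4)^n\<close>

definition legendre_weight :: "nat \<Rightarrow> real" where
  "legendre_weight m = real ((2 * m) choose m) * (- 1 / 4) ^ m / (fact m)\<^sup>2"

text \<open>This is the mean of the Legendre polynomial P_n against the weight 1/(pi sqrt(1 - u^2))
  on [-1, 1]: expand P_n(1 - 2x) in powers of x and use that the moments of 1/(pi sqrt(x(1 - x))) on
  [0, 1] are (2m choose m)/4^m. Parity of P_n explains the zeros at odd n.\<close>

definition legendre_sum :: "nat \<Rightarrow> real" where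
  "legendre_sum n = (\<Sum>m=0..n. legendre_weight m * fact (n + m) / fact (n - m))"

text \<open>Of the three factors m + 1, one comes from the recurrence of the central binomial
  coefficient and two from the squared factorial.\<close>

lemma legendre_weight_Suc:
  "2 * (real m + 1) ^ 3 * legendre_weight (Suc m) = - (2 * real m + 1) * legendre_weight m"
proof -
  define c where "c k = real ((2 * k) choose k)" for k
  have "2 * (real m + 1) ^ 3 * legendre_weight (Suc m)
      = - (1 / 2) * ((real m + 1) * c (Suc m)) * (- 1 / 4) ^ m / (fact m)\<^sup>2"
    unfolding legendre_weight_def c_def[symmetric]
    by (simp add: divide_simps power2_eq_square power3_eq_cube) (simp add: algebra_simps)
  also have "(real m + 1) * c (Suc m) = 2 * (2 * real m + 1) * c m"
    using central_binomial_Suc[of m] by (simp add: c_def add.commute)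
  finally show ?thesis
    unfolding legendre_weight_def c_def[symmetric] by (simp add: field_simps)
qed

lemma legendre_sum_rec:
  "(real n + 2)\<^sup>2 * legendre_sum (n + 2) = (real n + 1)\<^sup>2 * legendre_sum n"
proof -
  \<comment> \<open>\<open>T\<close> takes the smaller numerator and the larger denominator of the
    two sums, so that the summands for n and n + 2 are both polynomial multiples of
    \<open>T m\<close>.\<close>
  define T where "T m = legendre_weight m * fact (n + m) / fact (n + 2 - m)" for m
  \<comment> \<open>The Zeilberger certificate of the recurrence is \<open>- 2 (2n + 3) m\<^sup>3 T m\<close>.\<close>
  define G where "G m = - 2 * (2 * real n + 3) * real m ^ 3 * T m" for m
  define D where "D m = ((real n + 2)\<^sup>2 * (real n + real m + 1) * (real n + real m + 2)
      - (real n + 1)\<^sup>2 * (real n + 2 - real m) * (real n + 1 - real m)) * T m" for m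
  \<comment> \<open>The factorisation is arranged for telescoping: by \<open>T_Suc\<close> the first
    product contributes \<open>G (Suc m)\<close>, and the cubic term contributes
    \<open>- G m\<close>.\<close>
  have D_eq: "D m = (2 * real n + 3)
      * ((2 * real m + 1) * (real n + real m + 1) * (real n + 2 - real m) + 2 * real m ^ 3) * T m" for m
    unfolding D_def by (simp add: algebra_simps power2_eq_square power3_eq_cube)
  have T_Suc: "2 * (real m + 1) ^ 3 * T (Suc m)
      = - (2 * real m + 1) * (real n + real m + 1) * (real n + 2 - real m) * T m"
    if "m < n + 2" for m
  proof -
    have e: "n + 2 - m = Suc (n + 2 - Suc m)" using that by simp
    have f: "(fact (n + 2 - m) :: real) = (real n + 2 - real m) * fact (n + 2 - Suc m)"
      unfolding e fact_Suc using that by (simp add: of_nat_diff)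
    have "2 * (real m + 1) ^ 3 * T (Suc m)
        = (2 * (real m + 1) ^ 3 * legendre_weight (Suc m)) * ((real n + real m + 1) * fact (n + m))
            / fact (n + 2 - Suc m)"
      unfolding T_def by (simp add: algebra_simps)
    also have "\<dots> = - (2 * real m + 1) * (real n + real m + 1) * (legendre_weight m * fact (n + m))
            / fact (n + 2 - Suc m)"
      unfolding legendre_weight_Suc by (simp add: mult_ac)
    also have "\<dots> = - (2 * real m + 1) * (real n + real m + 1) * (real n + 2 - real m) * T m"
      unfolding T_def f using that by (simp add: divide_simps)
    finally show ?thesis .
  qed
  have G_Suc: "G m + D m = G (Suc m)" if "m < n + 2" for m
  proof -
    have "G (Suc m) = - (2 * real n + 3) * (2 * (real m + 1) ^ 3 * T (Suc m))"
      by (simp add: G_def add.commute)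
    also have "\<dots> = G m + D m"
      unfolding T_Suc[OF that] D_eq G_def by (simp add: algebra_simps)
    finally show ?thesis by simp
  qed
  \<comment> \<open>\<open>G 0 = 0\<close> because of the cube. Telescoping stops at n + 2, where
    the subtraction in the factorial would truncate, so the last term is added by hand; it cancels
    \<open>G (n + 2)\<close> because the factor n + 2 - m vanishes there.\<close>
  have "(\<Sum>m<k. D m) = G k" if "k \<le> n + 2" for k
    using that by (induction k) (simp_all add: G_def[of 0] G_Suc)
  from this[of "n + 2"] have "(\<Sum>m\<le>n + 2. D m) = G (n + 2) + D (n + 2)"
    by (metis lessThan_Suc_atMost order_refl sum.lessThan_Suc)
  also have "\<dots> = 0"
    unfolding D_eq G_def by (simp add: algebra_simps)
  finally have D0: "(\<Sum>m\<le>n + 2. D m) = 0" .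
  have S2: "legendre_sum (n + 2) = (\<Sum>m\<le>n + 2. (real n + real m + 1) * (real n + real m + 2) * T m)"
    unfolding legendre_sum_def atMost_atLeast0 by (rule sum.cong) (simp_all add: T_def field_simps)
  have "(real n + 2 - real m) * (real n + 1 - real m) * T m
      = legendre_weight m * fact (n + m) / fact (n - m)" if "m \<le> n" for m
  proof -
    have e: "n + 2 - m = Suc (Suc (n - m))" using that by simp
    have f: "(fact (n + 2 - m) :: real) = (real n + 2 - real m) * (real n + 1 - real m) * fact (n - m)"
      unfolding e fact_Suc using that by (simp add: of_nat_diff algebra_simps)
    have "real n + 2 - real m \<noteq> 0" "real n + 1 - real m \<noteq> 0" using that by linarith+
    then show ?thesis unfolding T_def f by simp
  qed
  then have "legendre_sum n = (\<Sum>m\<le>n. (real n + 2 - real m) * (real n + 1 - real m) * T m)"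
    unfolding legendre_sum_def atMost_atLeast0 by (intro sum.cong) simp_all
  \<comment> \<open>The two extra terms, m = n + 1 and m = n + 2, each contain a zero
    factor.\<close>
  also have "\<dots> = (\<Sum>m\<le>n + 2. (real n + 2 - real m) * (real n + 1 - real m) * T m)"
    by simp
  finally have S0: "legendre_sum n = \<dots>" .
  have "(\<Sum>m\<le>n + 2. D m) = (real n + 2)\<^sup>2 * legendre_sum (n + 2) - (real n + 1)\<^sup>2 * legendre_sum n"
    unfolding S2 S0 sum_distrib_left sum_subtractf[symmetric]
    by (rule sum.cong) (simp_all add: D_def left_diff_distrib mult.assoc)
  with D0 show ?thesis by simp
qed

lemma legendre_sum_even: "16 ^ k * legendre_sum (2 * k) = (real ((2 * k) choose k))\<^sup>2"
proof (induction k)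
  case 0
  then show ?case by (simp add: legendre_sum_def legendre_weight_def)
next
  case (Suc k)
  have "4 * (real k + 1)\<^sup>2 * legendre_sum (2 * Suc k) = (2 * real k + 1)\<^sup>2 * legendre_sum (2 * k)"
    using legendre_sum_rec[of "2 * k"] by (simp add: power2_eq_square algebra_simps)
  then have "(real k + 1)\<^sup>2 * (16 ^ Suc k * legendre_sum (2 * Suc k))
      = 4 * (2 * real k + 1)\<^sup>2 * (16 ^ k * legendre_sum (2 * k))"
    by (simp add: mult_ac del: mult_Suc_right)
  also have "\<dots> = (real k + 1)\<^sup>2 * (real ((2 * Suc k) choose Suc k))\<^sup>2"
    unfolding Suc.IH using central_binomial_Suc_sq[of k] by (simp add: add.commute)
  finally show ?case by (simp add: add_eq_0_iff)
qed

text \<open>The value at 1 is 1 - 1 = 0, and the leading coefficient of the recurrence is nonzero,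
  so the zero propagates in steps of two.\<close>

lemma legendre_sum_odd: "legendre_sum (Suc (2 * k)) = 0"
proof (induction k)
  case 0
  then show ?case by (simp add: legendre_sum_def legendre_weight_def)
next
  case (Suc k)
  then have "(real (Suc (2 * k)) + 2)\<^sup>2 * legendre_sum (Suc (2 * Suc k)) = 0"
    using legendre_sum_rec[of "Suc (2 * k)"] by simp
  then show ?case by (simp add: add_eq_0_iff)
qed

section \<open>Transfer to the integer sums (1) and (4)\<close>

lemma sum_central_binomial_sq_binomial_real:
  "(\<Sum>m=0..n. (real ((2 * m) choose m))\<^sup>2 * real ((n + m) choose (n - m)) * (- 4) ^ (n - m))
     = (- 4) ^ n * legendre_sum n"
  unfolding legendre_sum_def sum_distrib_left
proof (rule sum.cong)
  fix m assume "m \<in> {0..n}"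
  then have m: "m \<le> n" by simp
  have p: "(- 4 :: real) ^ n * (- 1 / 4) ^ m = (- 4) ^ (n - m)"
  proof -
    have "(- 4 :: real) ^ n = (- 4) ^ (n - m) * (- 4) ^ m"
      using m by (simp flip: power_add)
    then show ?thesis by (simp add: mult.assoc flip: power_mult_distrib)
  qed
  have c: "real ((2 * m) choose m) = fact (2 * m) / (fact m)\<^sup>2"
    by (subst binomial_fact) (simp_all add: mult_2 power2_eq_square)
  have b: "real ((n + m) choose (n - m)) = fact (n + m) / (fact (n - m) * fact (2 * m))"
    using m by (subst binomial_fact) (simp_all add: mult_2)
  \<comment> \<open>The factor (2m)! cancels; the remaining central binomial coefficient goes into
    \<open>legendre_weight\<close>.\<close>
  have "real ((2 * m) choose m) * real ((n + m) choose (n - m)) = fact (n + m) / (fact (n - m) * (fact m)\<^sup>2)"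
    unfolding b c by simp
  then have "(real ((2 * m) choose m))\<^sup>2 * real ((n + m) choose (n - m)) * (- 4) ^ (n - m)
      = real ((2 * m) choose m) * (fact (n + m) / (fact (n - m) * (fact m)\<^sup>2)) * (- 4) ^ (n - m)"
    by (simp only: power2_eq_square mult.assoc)
  also have "\<dots> = (- 4) ^ n * (legendre_weight m * fact (n + m) / fact (n - m))"
    unfolding legendre_weight_def p[symmetric] by (simp add: mult_ac)
  finally show "(real ((2 * m) choose m))\<^sup>2 * real ((n + m) choose (n - m)) * (- 4) ^ (n - m)
      = (- 4) ^ n * (legendre_weight m * fact (n + m) / fact (n - m))" .
qed simp

lemma sum_central_binomial_sq_binomial:
  "(\<Sum>m=0..n. (int ((2 * m) choose m))\<^sup>2 * int ((n + m) choose (n - m)) * (- 4) ^ (n - m))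
     = (if even n then (let k = n div 2 in (int ((2 * k) choose k))\<^sup>2) else 0)"
  (is "?L = ?R")
proof -
  have "real_of_int ?L = (- 4) ^ n * legendre_sum n"
    using sum_central_binomial_sq_binomial_real[of n] by simp
  also have "\<dots> = real_of_int ?R"
  proof (cases "even n")
    case True
    then obtain k where "n = 2 * k" by blast
    then show ?thesis using legendre_sum_even[of k] by (simp add: power_mult)
  next
    case False
    then obtain k where "n = Suc (2 * k)" by (auto elim: oddE)
    then show ?thesis using legendre_sum_odd[of k] by simp
  qed
  finally show ?thesis by (simp only: of_int_eq_iff)
qed

lemma sum_central_binomial_sq_binomial_double:
  "(\<Sum>m=0..2 * n. (int ((2 * m) choose m))\<^sup>2 * int ((2 * n + m) choose (2 * m)) * (- 1) ^ m * 4 ^ (2 * n - m))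
     = (int ((2 * n) choose n))\<^sup>2"
proof -
  have "(int ((2 * m) choose m))\<^sup>2 * int ((2 * n + m) choose (2 * m)) * (- 1) ^ m * 4 ^ (2 * n - m)
      = (int ((2 * m) choose m))\<^sup>2 * int ((2 * n + m) choose (2 * n - m)) * (- 4) ^ (2 * n - m)"
    if "m \<le> 2 * n" for m
  proof -
    have "(2 * n + m) choose (2 * m) = (2 * n + m) choose (2 * n - m)"
      using that binomial_symmetric[of "2 * m" "2 * n + m"] by simp
    \<comment> \<open>The exponent 2n - m has the parity of m.\<close>
    moreover have "(- 4 :: int) ^ (2 * n - m) = (- 1) ^ m * 4 ^ (2 * n - m)"
      using that by (cases "even m") simp_all
    ultimately show ?thesis by simp
  qed
  then have "(\<Sum>m=0..2 * n. (int ((2 * m) choose m))\<^sup>2 * int ((2 * n + m) choose (2 * m)) * (- 1) ^ m * 4 ^ (2 * n - m))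
      = (\<Sum>m=0..2 * n. (int ((2 * m) choose m))\<^sup>2 * int ((2 * n + m) choose (2 * n - m)) * (- 4) ^ (2 * n - m))"
    by (intro sum.cong) simp_all
  also have "\<dots> = (int ((2 * n) choose n))\<^sup>2"
    using sum_central_binomial_sq_binomial[of "2 * n"] by simp
  finally show ?thesis .
qed

theorem mainTheorem1:
  fixes n :: nat
  shows
   "(\<Sum>m=0..n. (int ((2 * m) choose m))\<^sup>2 * int ((n + m) choose (n - m)) * (- 4) ^ (n - m))
      = (if even n then (let k = n div 2 in (int ((2 * k) choose k))\<^sup>2) else 0)
    \<and> (\<Sum>m=0..n. (real ((2 * m) choose m))\<^sup>2 * ((real n - 1 / 2) gchoose (n - m)) * (- 1) ^ m * 16 ^ (n - m))
      = (real ((2 * n) choose n))\<^sup>2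
    \<and> (\<Sum>m=0..n. (real ((2 * m) choose m))\<^sup>2 * (16 ^ (n - m) / (1 - 2 * real m)))
      = (2 * real n + 1) * (real ((2 * n) choose n))\<^sup>2
    \<and> (\<Sum>m=0..2 * n. (int ((2 * m) choose m))\<^sup>2 * int ((2 * n + m) choose (2 * m)) * (- 1) ^ m * 4 ^ (2 * n - m))
      = (int ((2 * n) choose n))\<^sup>2"
  using sum_central_binomial_sq_binomial[of n] sum_central_binomial_sq_gbinomial[of n]
    sum_central_binomial_sq_div[of n] sum_central_binomial_sq_binomial_double[of n]
  by blast

end
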